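(* Let $G$ be a connected graph of order $n$, maximum degree $3$, and girth at least $5$. Then $$Z(G)\leq \frac{n}{2}-\frac{n}{24\log_2(n)+6}+2.$$
   Context: All graphs are finite, simple and undirected; the girth is the length of a shortest cycle (infinite for forests). For a graph $G$ and a set $Z\subseteq V(G)$, let $\mathcal{F}(Z)$ be the set obtained from $Z$ by repeatedly adding a vertex $u$ outside the current set whenever $u$ is the unique neighbor outside the current set of some vertex in the current set, as long as possible. $Z$ is a zero forcing set of $G$ if $\mathcal{F}(Z)=V(G)$. The zero forcing number $Z(G)$ is the minimum cardinality of a zero forcing set of $G$. *)

theory Defs
  imports Complex_Main "HOL-Library.Extended_Nat" "Graph_Theory.Graph_Theory"
begin

text \<open>
  A finite simple undirected graph is a \<^locale>\<open>pair_graph\<close>: finitely many vertices and a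
  symmetric irreflexive set of arcs. Every undirected edge is thus represented by its two
  orientations, and the degree of a vertex is its out-degree.
\<close>

definition nbhd :: "'a pair_pre_digraph \<Rightarrow> 'a \<Rightarrow> 'a set" where
  "nbhd G w = {u. (w, u) \<in> parcs G}"

definition max_degree :: "'a pair_pre_digraph \<Rightarrow> nat" where
  "max_degree G = Max (out_degree (with_proj G) ` pverts G)"

text \<open>
  The notion \<^const>\<open>pre_digraph.cycle\<close> also admits the closed walk of length two running along
  an edge and back, which is not a cycle of the undirected graph; hence the bound on the length.
  For a forest the infimum is over the empty set, so the girth is \<open>\<infinity>\<close>.
\<close>
definition girth :: "'a pair_pre_digraph \<Rightarrow> enat" where
  "girth G = (INF p \<in> {p. pre_digraph.cycle (with_proj G) p \<and> 3 \<le> length p}. enat (length p))"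

definition force_step :: "'a pair_pre_digraph \<Rightarrow> 'a set \<Rightarrow> 'a set \<Rightarrow> bool" where
  "force_step G S T \<longleftrightarrow> (\<exists>w\<in>S. \<exists>u. nbhd G w - S = {u} \<and> T = insert u S)"

text \<open>
  The set at which the forcing process gets stuck when started from \<open>Z\<close>; that such a set exists
  and does not depend on the order of the forcing steps is \<open>forcing_closure_unique\<close> below.
\<close>
definition forcing_closure :: "'a pair_pre_digraph \<Rightarrow> 'a set \<Rightarrow> 'a set" where
  "forcing_closure G Z = (THE T. (force_step G)\<^sup>*\<^sup>* Z T \<and> (\<nexists>U. force_step G T U))"

definition zero_forcing_set :: "'a pair_pre_digraph \<Rightarrow> 'a set \<Rightarrow> bool" where
  "zero_forcing_set G Z \<longleftrightarrow> Z \<subseteq> pverts G \<and> forcing_closure G Z = pverts G"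

definition zero_forcing_number :: "'a pair_pre_digraph \<Rightarrow> nat" where
  "zero_forcing_number G = Min (card ` {Z. zero_forcing_set G Z})"

lemma force_steps_subset_stuck:
  assumes "(force_step G)\<^sup>*\<^sup>* Z S" and "Z \<subseteq> T" and "\<nexists>U. force_step G T U"
  shows "S \<subseteq> T"
  using assms(1)
proof (induction rule: rtranclp_induct)
  case base
  show ?case by (rule assms(2))
next
  case (step S S')
  then obtain w u where w: "w \<in> S" "nbhd G w - S = {u}" "S' = insert u S"
    by (auto simp: force_step_def)
  have "u \<in> T"
  proof (rule ccontr)
    assume "u \<notin> T"
    with w step.IH have "nbhd G w - T = {u}" by blast
    with w(1) step.IH assms(3) show False by (auto simp: force_step_def)
  qed
  with w step.IH show ?case by simp
qed

lemma force_steps_increasing: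
  assumes "(force_step G)\<^sup>*\<^sup>* Z S"
  shows "Z \<subseteq> S"
  using assms by (induction rule: rtranclp_induct) (auto simp: force_step_def)

lemma forcing_closure_exists:
  assumes "pair_graph G" and "Z \<subseteq> pverts G"
  shows "\<exists>T. (force_step G)\<^sup>*\<^sup>* Z T \<and> (\<nexists>U. force_step G T U)"
  using assms(2)
proof (induction "card (pverts G - Z)" arbitrary: Z rule: less_induct)
  case less
  interpret pair_graph G by (rule assms(1))
  show ?case
  proof (cases "\<exists>U. force_step G Z U")
    case False
    then show ?thesis by blast
  next
    case True
    then obtain w u where w: "w \<in> Z" "nbhd G w - Z = {u}"
      by (auto simp: force_step_def)
    then have step: "force_step G Z (insert u Z)" by (auto simp: force_step_def)
    from w have "(w, u) \<in> parcs G" and u: "u \<notin> Z" by (auto simp: nbhd_def)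
    then have uV: "u \<in> pverts G" using arc_snd_in_verts by fastforce
    have "card (pverts G - insert u Z) < card (pverts G - Z)"
      using u uV by (intro psubset_card_mono) auto
    from less.hyps[OF this] uV less.prems step show ?thesis
      by (meson converse_rtranclp_into_rtranclp insert_subset)
  qed
qed

lemma forcing_closure_unique:
  assumes "pair_graph G" and "Z \<subseteq> pverts G"
  shows "\<exists>!T. (force_step G)\<^sup>*\<^sup>* Z T \<and> (\<nexists>U. force_step G T U)"
  using forcing_closure_exists[OF assms]
  by (meson force_steps_increasing force_steps_subset_stuck subset_antisym)

lemma zero_forcing_set_pverts:
  assumes "pair_graph G"
  shows "zero_forcing_set G (pverts G)"
proof -
  interpret pair_graph G by (rule assms)
  have stuck: "\<nexists>U. force_step G (pverts G) U"
  proof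
    assume "\<exists>U. force_step G (pverts G) U"
    then obtain w u where "nbhd G w - pverts G = {u}" by (auto simp: force_step_def)
    then have "(w, u) \<in> parcs G" "u \<notin> pverts G" by (auto simp: nbhd_def)
    then show False using arc_snd_in_verts by fastforce
  qed
  have "forcing_closure G (pverts G) = pverts G"
    unfolding forcing_closure_def
    by (rule the1_equality[OF forcing_closure_unique[OF assms subset_refl]]) (simp add: stuck)
  then show ?thesis by (simp add: zero_forcing_set_def)
qed

lemma zero_forcing_number_attained:
  assumes "pair_graph G"
  obtains Z where "zero_forcing_set G Z" and "card Z = zero_forcing_number G"
proof -
  interpret pair_graph G by (rule assms)
  have "{Z. zero_forcing_set G Z} \<subseteq> Pow (pverts G)" by (auto simp: zero_forcing_set_def)
  then have "finite {Z. zero_forcing_set G Z}"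
    by (rule finite_subset) simp
  then have "zero_forcing_number G \<in> card ` {Z. zero_forcing_set G Z}"
    unfolding zero_forcing_number_def
    using zero_forcing_set_pverts[OF assms] by (intro Min_in) auto
  then show ?thesis using that by auto
qed

end

theory Submission
  imports Defs
begin

text \<open>
  Grow an infected set \<open>F\<close> greedily. Once \<open>F\<close> is stuck, a boundary vertex has exactly two outside
  neighbours, and paying for one of them infects both; this gives \<open>n/2\<close>. A \<^emph>\<open>gain\<close> is a set of
  \<open>j\<close> paid vertices infecting at least \<open>2j + 1\<close> new ones, and it suffices to find, again and again, a
  gain with \<open>j \<le> k = 2\<lceil>log\<^sub>2 n\<rceil> + 1\<close>. Suppose there is none, and pay successively along a
  non-backtracking walk that leaves \<open>F\<close> at a boundary vertex \<open>a\<close>. Since triangles and squares are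
  absent, every new vertex of the walk has a single infected neighbour and two outside ones, so for
  \<open>k + 1\<close> steps the walk does not come back to \<open>a\<close>. If two such walks of length
  \<open>\<lceil>log\<^sub>2 n\<rceil> + 1\<close> met, one followed by the reverse of the other would come back; hence
  at least \<open>n\<close> vertices would lie outside \<open>F\<close>.

  The walk must start at an outside neighbour of \<open>a\<close> that is not a leaf. Two leaves with a common
  neighbour are therefore deleted beforehand, together with that neighbour: a single paid leaf
  accounts for all three vertices.
\<close>

section \<open>Forcing in subcubic graphs without triangles and squares\<close>

locale subcubic_graph =
  fixes V :: "'a set" and E :: "'a \<Rightarrow> 'a \<Rightarrow> bool"
  assumes finite_V: "finite V"
    and E_sym: "E x y \<Longrightarrow> E y x"
    and E_irrefl: "\<not> E x x"
    and no_triangle: "E x y \<Longrightarrow> E y z \<Longrightarrow> \<not> E z x"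
    and no_square: "E x y \<Longrightarrow> E y z \<Longrightarrow> E z w \<Longrightarrow> E w x \<Longrightarrow> x \<noteq> z \<Longrightarrow> y = w"
    and deg: "w \<in> V \<Longrightarrow> card {u \<in> V. E w u} \<le> 3"
    and connected_V: "S \<subseteq> V \<Longrightarrow> S \<noteq> {} \<Longrightarrow> S \<noteq> V \<Longrightarrow> \<exists>x\<in>S. \<exists>y\<in>V - S. E x y"
begin

definition N :: "'a \<Rightarrow> 'a set" where "N w = {u \<in> V. E w u}"

text \<open>\<open>T\<close> may reach outside \<open>V\<close>, so that a set stuck in the whole
  graph can be reused for an induced subgraph.\<close>

definition stuck :: "'a set \<Rightarrow> bool" where
  "stuck T \<longleftrightarrow> (\<forall>w\<in>T \<inter> V. \<forall>u. N w - T \<noteq> {u})"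

text \<open>For \<open>Z\<close> inside \<open>V\<close> this places \<open>A\<close> in the forcing
  closure, the least stuck superset of \<open>Z\<close>, without handling sequences of
  steps.\<close>

definition forces :: "'a set \<Rightarrow> 'a set \<Rightarrow> bool" where
  "forces Z A \<longleftrightarrow> (\<forall>T. Z \<subseteq> T \<longrightarrow> stuck T \<longrightarrow> A \<subseteq> T)"

text \<open>The subgraph induced by \<open>Y\<close> has no isolated vertex; as degrees are at most
  3, this caps the outside neighbours of each member at two.\<close>

definition spread :: "'a set \<Rightarrow> bool" where
  "spread Y \<longleftrightarrow> Y \<subseteq> V \<and> (\<forall>y\<in>Y. \<exists>x\<in>Y. E y x)"

definition gain :: "'a set \<Rightarrow> nat \<Rightarrow> bool" where
  "gain F k \<longleftrightarrow> (\<exists>X Y. X \<subseteq> V \<and> card X \<le> k \<and> F \<subseteq> Y \<and> forces (F \<union> X) Y \<and> spread Y \<and>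
     card F + 2 * card X + 1 \<le> card Y)"

text \<open>The situation after \<open>i\<close> payments, each of which infected exactly two vertices.\<close>
definition even_state :: "'a set \<Rightarrow> nat \<Rightarrow> 'a set \<Rightarrow> bool" where
  "even_state F i A \<longleftrightarrow> F \<subseteq> A \<and> spread A \<and> card A = card F + 2 * i \<and>
     (\<exists>X. X \<subseteq> V \<and> card X \<le> i \<and> forces (F \<union> X) A)"

lemma N_subset: "N w \<subseteq> V"
  and finite_N [simp]: "finite (N w)"
  and in_N_iff: "u \<in> N w \<longleftrightarrow> u \<in> V \<and> E w u"
  using finite_V by (auto simp: N_def)

lemma card_N: "w \<in> V \<Longrightarrow> card (N w) \<le> 3"
  using deg by (simp add: N_def)

lemma stuckD: "stuck T \<Longrightarrow> w \<in> T \<Longrightarrow> w \<in> V \<Longrightarrow> u \<in> N w \<Longrightarrow> N w - T \<subseteq> {u} \<Longrightarrow> u \<in> T"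
  unfolding stuck_def by blast

lemma E_commute: "E x y \<longleftrightarrow> E y x"
  using E_sym by blast

lemma forces_trans: "forces Z A \<Longrightarrow> forces (A \<union> X) B \<Longrightarrow> forces (Z \<union> X) B"
  unfolding forces_def by (meson Un_least Un_upper1 Un_upper2 subset_trans)

lemma card_outside_le_2:
  assumes "spread A" "w \<in> A"
  shows "card (N w - A) \<le> 2"
proof -
  obtain x where x: "x \<in> A" "E w x" "x \<in> V" "w \<in> V"
    using assms unfolding spread_def by blast
  then have "x \<in> N w" by (simp add: in_N_iff)
  with x(1) have "N w - A \<subset> N w" by blast
  then have "card (N w - A) < card (N w)" by (intro psubset_card_mono) auto
  with card_N[OF x(4)] show ?thesis by simp
qed

section \<open>Even states and their local structure when no gain is available\<close>

text \<open>The \<open>i\<close> payments behind \<open>A\<close> break even, so \<open>j\<close>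
  more that infect over \<open>2 * j\<close> new vertices make a gain at total cost
  \<open>i + j\<close>.\<close>

lemma gainI:
  assumes st: "even_state F i A" and "B \<inter> A = {}" "B \<subseteq> V" "2 * j < card B"
    and C: "C \<subseteq> V" "card C \<le> j"
    and forced: "\<And>T. A \<union> C \<subseteq> T \<Longrightarrow> stuck T \<Longrightarrow> B \<subseteq> T"
    and nb: "\<And>b. b \<in> B \<Longrightarrow> \<exists>x\<in>A \<union> B. E b x"
    and le: "i + j \<le> k"
  shows "gain F k"
proof -
  from st obtain X where X: "X \<subseteq> V" "card X \<le> i" "forces (F \<union> X) A"
    and A: "F \<subseteq> A" "spread A" "card A = card F + 2 * i"
    unfolding even_state_def by blast
  have fin: "finite A" "finite B"
    using A(2) assms(3) finite_V finite_subset unfolding spread_def by blast+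
  have card: "card (X \<union> C) \<le> i + j" using card_Un_le[of X C] X(2) C(2) by simp
  have "forces (F \<union> (X \<union> C)) (A \<union> B)"
    unfolding forces_def
  proof (intro allI impI)
    fix T assume T: "F \<union> (X \<union> C) \<subseteq> T" "stuck T"
    with X(3) have "A \<subseteq> T" unfolding forces_def by blast
    with T forced[of T] show "A \<union> B \<subseteq> T" by blast
  qed
  moreover have "spread (A \<union> B)"
    using A(2) assms(3) nb unfolding spread_def by blast
  moreover have "card (A \<union> B) = card A + card B"
    using fin assms(2) by (intro card_Un_disjoint) auto
  ultimately show ?thesis
    unfolding gain_def using X C A card le assms(4)
    by (intro exI[of _ "X \<union> C"] exI[of _ "A \<union> B"]) auto
qed

text \<open>The forced vertex \<open>u\<close> would come free of charge: a gain with
  \<open>j = 0\<close>.\<close>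

lemma even_state_stuck:
  assumes st: "even_state F i A" and "i \<le> k" "\<not> gain F k" "w \<in> A"
  shows "N w - A \<noteq> {u}"
proof
  assume u: "N w - A = {u}"
  have w: "w \<in> V" using st assms(4) unfolding even_state_def spread_def by blast
  have "u \<in> N w" "u \<notin> A" using u by blast+
  have "gain F k"
  proof (rule gainI[OF st, of "{u}" 0 "{}"])
    show "{u} \<subseteq> T" if "A \<union> {} \<subseteq> T" "stuck T" for T
      using stuckD[OF that(2) _ w \<open>u \<in> N w\<close>] that(1) u assms(4) by blast
    show "\<exists>x\<in>A \<union> {u}. E b x" if "b \<in> {u}" for b
      using that \<open>u \<in> N w\<close> assms(4) by (auto simp: in_N_iff E_commute)
  qed (use \<open>u \<in> N w\<close> \<open>u \<notin> A\<close> assms in \<open>auto simp: in_N_iff\<close>)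
  with assms(3) show False ..
qed

lemma outside_pair:
  assumes st: "even_state F i A" and "i \<le> k" "\<not> gain F k" "w \<in> A" "u \<in> N w - A"
  obtains v where "N w - A = {u, v}" "u \<noteq> v"
proof -
  have sp: "spread A" using st by (simp add: even_state_def)
  have "card (N w - A) \<noteq> 1"
    using even_state_stuck[OF assms(1-4)] by (auto simp: card_1_singleton_iff)
  moreover have "card (N w - A) \<noteq> 0" using assms(5) by auto
  ultimately have "card (N w - A) = 2"
    using card_outside_le_2[OF sp assms(4)] by linarith
  then obtain a b where "N w - A = {a, b}" "a \<noteq> b" by (auto simp: card_2_iff)
  with assms(5) that show thesis by (cases "u = a") auto
qed

text \<open>Paying for \<open>u\<close> leaves \<open>v\<close> as the only outside neighbour of
  \<open>w\<close>, which then forces it.\<close>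

lemma even_state_extend:
  assumes st: "even_state F i A" and w: "w \<in> A" "N w - A = {u, v}" "u \<noteq> v"
  shows "even_state F (Suc i) (A \<union> {u, v})"
proof -
  from st obtain X where X: "X \<subseteq> V" "card X \<le> i" "forces (F \<union> X) A"
    and A: "F \<subseteq> A" "spread A" "card A = card F + 2 * i"
    unfolding even_state_def by blast
  have wV: "w \<in> V" using A(2) w(1) unfolding spread_def by blast
  have uv: "u \<in> N w" "v \<in> N w" "u \<notin> A" "v \<notin> A" using w by blast+
  have fin: "finite A" using A(2) finite_V finite_subset unfolding spread_def by blast
  have "forces (F \<union> insert u X) (A \<union> {u, v})"
    unfolding forces_def
  proof (intro allI impI)
    fix T assume T: "F \<union> insert u X \<subseteq> T" "stuck T"
    with X(3) have "A \<subseteq> T" unfolding forces_def by blast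
    then have "v \<in> T" using stuckD[OF T(2) _ wV uv(2)] w T(1) by blast
    with \<open>A \<subseteq> T\<close> T show "A \<union> {u, v} \<subseteq> T" by blast
  qed
  moreover have "card (insert u X) \<le> Suc i" using X(2) card_insert_le_m1[of "Suc i" X u] by simp
  moreover have "spread (A \<union> {u, v})"
    using A(2) uv w(1) unfolding spread_def by (auto simp: in_N_iff E_commute)
  moreover have "card (A \<union> {u, v}) = card A + 2"
    using fin uv w(3) by simp
  moreover have "insert u X \<subseteq> V" using X(1) uv by (auto simp: in_N_iff)
  ultimately show ?thesis unfolding even_state_def using A by (intro conjI exI[of _ "insert u X"]) auto
qed

text \<open>
  If \<open>u\<close> were outside neighbour of both \<open>w\<close> and \<open>z\<close>, then paying for \<open>u\<close> would let both of them
  force, and they force different vertices as there are no squares.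
\<close>
lemma outside_pairs_disjoint:
  assumes st: "even_state F i A" and "i < k" "\<not> gain F k"
    and w: "w \<in> A" "N w - A = {u, v}" "u \<noteq> v" and z: "z \<in> A" "u \<in> N z"
  shows "z = w"
proof (rule ccontr)
  assume "z \<noteq> w"
  have V: "w \<in> V" "z \<in> V" using st w z unfolding even_state_def spread_def by blast+
  have u: "u \<in> N z - A" using w z by blast
  from outside_pair[OF st _ assms(3) z(1) u] assms(2)
  obtain y where y: "N z - A = {u, y}" "u \<noteq> y" by auto
  have yz: "y \<in> N z" "y \<notin> A" using y by blast+
  have vw: "v \<in> N w" "v \<notin> A" "u \<in> N w" "u \<notin> A" using w by blast+
  have "y \<noteq> v"
    using no_square[of w u z v] vw yz z(2) w(3) \<open>z \<noteq> w\<close> by (auto simp: in_N_iff E_commute)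
  have "gain F k"
  proof (rule gainI[OF st, of "{u, v, y}" 1 "{u}"])
    show "{u, v, y} \<subseteq> T" if T: "A \<union> {u} \<subseteq> T" "stuck T" for T
      using stuckD[OF T(2) _ V(1) vw(1)] stuckD[OF T(2) _ V(2) yz(1)] T(1) w z y by blast
    show "\<exists>x\<in>A \<union> {u, v, y}. E b x" if "b \<in> {u, v, y}" for b
      using that vw yz z w(1) by (auto simp: in_N_iff E_commute)
  qed (use vw yz \<open>y \<noteq> v\<close> y w assms in \<open>auto simp: in_N_iff\<close>)
  with assms(3) show False ..
qed

text \<open>Paying for the leaf \<open>c\<close> instead of \<open>u\<close> infects \<open>c\<close>, \<open>u\<close> and \<open>v\<close>.\<close>
lemma outside_pair_no_leaf:
  assumes st: "even_state F i A" and "i < k" "\<not> gain F k"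
    and w: "w \<in> A" "N w - A = {u, v}" "u \<noteq> v" and c: "c \<in> N u" "c \<noteq> w"
  shows "N c \<noteq> {u}"
proof
  assume leaf: "N c = {u}"
  have wV: "w \<in> V" using st w unfolding even_state_def spread_def by blast
  have vw: "v \<in> N w" "v \<notin> A" "u \<in> N w" "u \<notin> A" using w by blast+
  have "c \<notin> A"
  proof
    assume "c \<in> A"
    with even_state_stuck[OF st _ assms(3), of c u] leaf vw assms(2) show False by auto
  qed
  have cV: "c \<in> V" using c(1) by (simp add: in_N_iff)
  have "c \<noteq> v"
    using no_triangle[of w u c] c(1) vw by (auto simp: in_N_iff E_commute)
  have "c \<noteq> u" using c E_irrefl by (auto simp: in_N_iff)
  have "gain F k"
  proof (rule gainI[OF st, of "{u, v, c}" 1 "{c}"])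
    show "{u, v, c} \<subseteq> T" if T: "A \<union> {c} \<subseteq> T" "stuck T" for T
    proof -
      have "u \<in> T" using stuckD[OF T(2) _ cV, of u] leaf T(1) by auto
      have "N w - T \<subseteq> (N w - A) - {u}" using T(1) \<open>u \<in> T\<close> by blast
      then have "N w - T \<subseteq> {v}" unfolding w(2) by blast
      then have "v \<in> T" using stuckD[OF T(2) _ wV vw(1)] T(1) w(1) by blast
      with \<open>u \<in> T\<close> T(1) show ?thesis by blast
    qed
    show "\<exists>x\<in>A \<union> {u, v, c}. E b x" if "b \<in> {u, v, c}" for b
      using that vw c w(1) by (auto simp: in_N_iff E_commute)
  qed (use vw c \<open>c \<noteq> v\<close> \<open>c \<noteq> u\<close> \<open>c \<notin> A\<close> w assms in \<open>auto simp: in_N_iff\<close>)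
  with assms(3) show False ..
qed

text \<open>The induction step along a walk. Absence of triangles and
  \<open>outside_pairs_disjoint\<close> leave \<open>w\<close> as the only infected neighbour of
  \<open>u\<close>; \<open>nonleaf\<close> then gives an outside neighbour, hence two. The last
  conclusion supplies \<open>nonleaf\<close> for the next step.\<close>

lemma even_state_advance:
  assumes st: "even_state F i A" and "i < k" "\<not> gain F k"
    and w: "w \<in> A" "N w - A = {u, v}" "u \<noteq> v" and nonleaf: "N u \<noteq> {w}"
  defines "A' \<equiv> A \<union> {u, v}"
  shows "even_state F (Suc i) A'" and "N u \<inter> A' = {w}" and "card (N u - A') = 2"
    and "\<forall>c\<in>N u - {w}. N c \<noteq> {u}"
proof -
  show st': "even_state F (Suc i) A'"
    unfolding A'_def by (rule even_state_extend[OF st w])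
  have uV: "u \<in> V" and wV: "w \<in> V" using w st unfolding even_state_def spread_def N_def by blast+
  have uw: "u \<in> N w" "v \<in> N w" using w by blast+
  have wu: "w \<in> N u" using uw wV by (auto simp: in_N_iff E_commute)
  have "u \<notin> N u" using E_irrefl by (auto simp: in_N_iff)
  moreover have "v \<notin> N u" using no_triangle[of w u v] uw by (auto simp: in_N_iff E_commute)
  moreover have "z = w" if "z \<in> N u" "z \<in> A" for z
    using outside_pairs_disjoint[OF st assms(2,3) w, of z] that uV by (auto simp: in_N_iff E_commute)
  ultimately show one: "N u \<inter> A' = {w}" using wu w unfolding A'_def by blast
  then have "N u - A' \<noteq> {}" using nonleaf by blast
  then obtain x where "x \<in> N u - A'" by blast
  moreover have "u \<in> A'" by (simp add: A'_def)
  ultimately obtain y where "N u - A' = {x, y}" "x \<noteq> y"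
    using outside_pair[OF st' _ assms(3), of u x] assms(2) by auto
  then show "card (N u - A') = 2" by simp
  show "\<forall>c\<in>N u - {w}. N c \<noteq> {u}"
    using outside_pair_no_leaf[OF st assms(2,3) w] by blast
qed

section \<open>Non-backtracking walks leaving the infected set\<close>

text \<open>As a function on \<open>nat\<close>, a walk is shortened by lowering \<open>t\<close>
  alone and prolonged by a function update.\<close>

definition walk :: "'a \<Rightarrow> 'a \<Rightarrow> nat \<Rightarrow> (nat \<Rightarrow> 'a) \<Rightarrow> bool" where
  "walk a b t p \<longleftrightarrow> p 0 = a \<and> p 1 = b \<and> (\<forall>i<t. p (Suc i) \<in> N (p i)) \<and>
     (\<forall>i. Suc (Suc i) \<le> t \<longrightarrow> p (Suc (Suc i)) \<noteq> p i)"

text \<open>Step \<open>i\<close> pays for \<open>p i\<close>. Without backtracking, the next vertex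
  is not the unique infected neighbour of \<open>p i\<close>, so it lies outside \<open>A\<close>
  and \<open>even_state_advance\<close> applies.\<close>

lemma walk_state:
  assumes "\<not> gain F k" and "spread F"
    and a: "a \<in> F" "N a - F = {b, b'}" "b \<noteq> b'" and nonleaf: "N b \<noteq> {a}"
    and p: "walk a b t p"
  shows "1 \<le> i \<Longrightarrow> i \<le> t \<Longrightarrow> i \<le> k \<Longrightarrow>
    \<exists>A. even_state F i A \<and> p i \<in> A \<and> N (p i) \<inter> A = {p (i - 1)} \<and> card (N (p i) - A) = 2 \<and>
      (\<forall>c\<in>N (p i) - {p (i - 1)}. N c \<noteq> {p i})"
proof (induction i rule: nat_induct_at_least)
  case base
  have "even_state F 0 F"
    using assms(2) unfolding even_state_def
    by (intro conjI exI[of _ "{}"]) (auto simp: forces_def)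
  from even_state_advance[OF this _ assms(1) a nonleaf] base p
  show ?case unfolding walk_def by (intro exI[of _ "F \<union> {b, b'}"]) auto
next
  case (Suc i)
  then obtain A where A: "even_state F i A" "p i \<in> A" "N (p i) \<inter> A = {p (i - 1)}"
    "card (N (p i) - A) = 2" and no_leaf: "\<forall>c\<in>N (p i) - {p (i - 1)}. N c \<noteq> {p i}" by auto
  obtain j where j: "i = Suc j" using Suc.hyps by (cases i) auto
  have "p (Suc i) \<in> N (p i)" "p (Suc i) \<noteq> p (i - 1)"
    using p Suc.prems j unfolding walk_def by auto
  with A(3) have "p (Suc i) \<in> N (p i) - A" by blast
  then obtain v where v: "N (p i) - A = {p (Suc i), v}" "p (Suc i) \<noteq> v"
    using outside_pair[OF A(1) _ assms(1) A(2)] Suc.prems by auto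
  have "N (p (Suc i)) \<noteq> {p i}"
    using no_leaf \<open>p (Suc i) \<in> N (p i)\<close> \<open>p (Suc i) \<noteq> p (i - 1)\<close> by blast
  from even_state_advance[OF A(1) _ assms(1) A(2) v this] Suc.prems
  show ?case by (intro exI[of _ "A \<union> {p (Suc i), v}"]) auto
qed

text \<open>The last step leads outside an even state, which contains \<open>a\<close>. That step is
  not paid for, so \<open>t\<close> may be as large as \<open>Suc k\<close>.\<close>

lemma walk_not_start:
  assumes "\<not> gain F k" and "spread F"
    and "a \<in> F" "N a - F = {b, b'}" "b \<noteq> b'" "N b \<noteq> {a}"
    and p: "walk a b t p" and t: "1 \<le> t" "t \<le> Suc k"
  shows "p t \<noteq> a"
proof (cases "t = 1")
  case True
  have "b \<notin> F" using assms(4) by blast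
  with True p assms(3) show ?thesis unfolding walk_def by auto
next
  case False
  then obtain i where i: "t = Suc (Suc i)" using t(1)
    by (cases t; cases "t - 1") auto
  from walk_state[OF assms(1-7), of "Suc i"] i t
  obtain A where A: "even_state F (Suc i) A" "N (p (Suc i)) \<inter> A = {p i}" by auto
  have "p t \<in> N (p (Suc i))" "p t \<noteq> p i" using p i unfolding walk_def by auto
  with A(2) have "p t \<notin> A" by blast
  with A(1) assms(3) show ?thesis unfolding even_state_def by blast
qed

lemma walk_in_V:
  assumes "walk a b t p" "a \<in> V" "i \<le> t"
  shows "p i \<in> V"
proof (cases i)
  case 0
  with assms show ?thesis by (simp add: walk_def)
next
  case (Suc j)
  with assms have "p i \<in> N (p j)" by (simp add: walk_def)
  with N_subset show ?thesis by blast
qed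

text \<open>Out along \<open>p\<close>, home along \<open>p'\<close>. Backtracking could arise only
  at the turn, index \<open>t\<close>, where the differing penultimate vertices prevent it.\<close>

lemma walk_join:
  assumes p: "walk a b t p" and p': "walk a b t p'" and "a \<in> V" "1 \<le> t"
    and "p t = p' t" "p (t - 1) \<noteq> p' (t - 1)"
  shows "walk a b (2 * t) (\<lambda>i. if i \<le> t then p i else p' (2 * t - i))" (is "walk _ _ _ ?q")
  unfolding walk_def
proof (intro conjI allI impI)
  show "?q 0 = a" "?q 1 = b" using p assms(4) by (auto simp: walk_def)
next
  fix i assume i: "i < 2 * t"
  show "?q (Suc i) \<in> N (?q i)"
  proof (cases "i < t")
    case True
    with p show ?thesis by (simp add: walk_def)
  next
    case False
    \<comment> \<open>The second half runs through \<open>p'\<close> backwards, here from index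
      \<open>Suc j\<close> to \<open>j\<close>.\<close>
    define j where "j = 2 * t - Suc i"
    have j: "Suc j = 2 * t - i" "j < t" using False i by (auto simp: j_def)
    have "p' (Suc j) \<in> N (p' j)" using p' j(2) by (simp add: walk_def)
    moreover have "p' j \<in> V" using walk_in_V[OF p' assms(3)] j by simp
    ultimately have "p' j \<in> N (p' (Suc j))" by (auto simp: in_N_iff E_commute)
    moreover have "?q i = p' (Suc j)"
      using False j assms(5) by (cases "i = t") auto
    moreover have "?q (Suc i) = p' j" using False j_def by simp
    ultimately show ?thesis by simp
  qed
next
  fix i assume i: "Suc (Suc i) \<le> 2 * t"
  consider "Suc (Suc i) \<le> t" | "Suc i = t" | "t \<le> i" by linarith
  then show "?q (Suc (Suc i)) \<noteq> ?q i"
  proof cases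
    case 1
    with p show ?thesis by (simp add: walk_def)
  next
    case 2
    then have "2 * t - Suc (Suc i) = t - 1" "i = t - 1" by auto
    with 2 assms(6) show ?thesis by simp
  next
    case 3
    define j where "j = 2 * t - Suc (Suc i)"
    have j: "Suc (Suc j) = 2 * t - i" using 3 i by (auto simp: j_def)
    have "Suc (Suc j) \<le> t" using j 3 by linarith
    then have "p' (Suc (Suc j)) \<noteq> p' j" using p' by (simp add: walk_def)
    moreover have "?q i = p' (Suc (Suc j))"
      using 3 j assms(5) by (cases "i = t") auto
    moreover have "?q (Suc (Suc i)) = p' j" using 3 j_def by simp
    ultimately show ?thesis by simp
  qed
qed

text \<open>Otherwise the joined walk would arrive at \<open>a\<close> after \<open>2 * t\<close>
  steps, against \<open>walk_not_start\<close>.\<close>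

lemma walk_unique_last_step:
  assumes "\<not> gain F k" and "spread F"
    and "a \<in> F" "N a - F = {b, b'}" "b \<noteq> b'" "N b \<noteq> {a}"
    and "walk a b t p" "walk a b t p'" and "1 \<le> t" "2 * t \<le> Suc k" and "p t = p' t"
  shows "p (t - 1) = p' (t - 1)"
proof (rule ccontr)
  assume ne: "p (t - 1) \<noteq> p' (t - 1)"
  have "a \<in> V" using assms(2,3) unfolding spread_def by blast
  from walk_not_start[OF assms(1-6) walk_join[OF assms(7,8) this assms(9,11) ne]] assms(8-10)
  show False by (auto simp: walk_def split: if_splits)
qed

section \<open>Doubling of walk ends, and existence of a gain\<close>

text \<open>Last edges are counted rather than end vertices, because the last edge decides how a
  walk can be continued: in exactly two ways.\<close>

lemma card_walk_ends:
  assumes ng: "\<not> gain F (2 * m + 1)" and "spread F"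
    and "a \<in> F" "N a - F = {b, b'}" "b \<noteq> b'" "N b \<noteq> {a}"
  defines "Q \<equiv> \<lambda>t. {(p (t - 1), p t) | p. walk a b t p}"
  shows "1 \<le> t \<Longrightarrow> t \<le> m + 1 \<Longrightarrow> card (Q t) = 2 ^ (t - 1)"
proof (induction t rule: nat_induct_at_least)
  case base
  have "b \<in> N a" using assms(4) by blast
  then have w: "walk a b 1 (\<lambda>i. if i = 0 then a else b)" by (auto simp: walk_def)
  have "(a, b) \<in> Q 1"
    unfolding Q_def mem_Collect_eq by (rule exI[of _ "\<lambda>i. if i = 0 then a else b"]) (use w in simp)
  moreover have "Q 1 \<subseteq> {(a, b)}" by (auto simp: Q_def walk_def)
  ultimately have "Q 1 = {(a, b)}" by blast
  then show ?case by simp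
next
  case (Suc t)
  have aV: "a \<in> V" using assms(2,3) unfolding spread_def by blast
  define S where "S = (\<lambda>e::'a \<times> 'a. {snd e} \<times> (N (snd e) - {fst e}))"
  have "Q (Suc t) = (\<Union>e\<in>Q t. S e)"
  proof (intro equalityI subsetI)
    fix e assume "e \<in> Q (Suc t)"
    then obtain p where p: "walk a b (Suc t) p" "e = (p t, p (Suc t))" by (auto simp: Q_def)
    then have "walk a b t p" by (auto simp: walk_def)
    then have "(p (t - 1), p t) \<in> Q t" by (auto simp: Q_def)
    moreover have "p (Suc t) \<noteq> p (t - 1)" "p (Suc t) \<in> N (p t)"
      using p(1) Suc.hyps by (cases t; auto simp: walk_def)+
    ultimately show "e \<in> (\<Union>e\<in>Q t. S e)" using p(2) unfolding S_def by force
  next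
    fix e assume "e \<in> (\<Union>e\<in>Q t. S e)"
    then obtain p y where p: "walk a b t p" "e = (p t, y)" "y \<in> N (p t)" "y \<noteq> p (t - 1)"
      by (auto simp: Q_def S_def)
    have "walk a b (Suc t) (p(Suc t := y))"
      using p Suc.hyps by (auto simp: walk_def less_Suc_eq le_Suc_eq)
    with p(2) show "e \<in> Q (Suc t)" unfolding Q_def by (auto intro!: exI[of _ "p(Suc t := y)"])
  qed
  moreover have "card (\<Union>e\<in>Q t. S e) = (\<Sum>e\<in>Q t. card (S e))"
  proof (rule card_UN_disjoint)
    have "Q t \<subseteq> V \<times> V" unfolding Q_def using walk_in_V[OF _ aV] by auto
    then show "finite (Q t)" using finite_V finite_subset by blast
    show "\<forall>e\<in>Q t. finite (S e)" by (simp add: S_def)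
    \<comment> \<open>A common element would give two walks with the same end but different last
      steps.\<close>
    show "\<forall>e\<in>Q t. \<forall>f\<in>Q t. e \<noteq> f \<longrightarrow> S e \<inter> S f = {}"
      using walk_unique_last_step[OF assms(1-6)] Suc.hyps Suc.prems
      by (fastforce simp: Q_def S_def)
  qed
  moreover have "card (S e) = 2" if e: "e \<in> Q t" for e
  proof -
    obtain p where p: "walk a b t p" "e = (p (t - 1), p t)" using e by (auto simp: Q_def)
    from walk_state[OF assms(1-6) p(1), of t] Suc.hyps Suc.prems
    obtain A where A: "N (p t) \<inter> A = {p (t - 1)}" "card (N (p t) - A) = 2" by auto
    then have "N (p t) - A = N (p t) - {p (t - 1)}" by blast
    with A(2) p(2) show ?thesis by (simp add: S_def card_cartesian_product)
  qed
  ultimately have "card (Q (Suc t)) = 2 * card (Q t)" by simp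
  with Suc show ?case by (cases t) auto
qed

lemma gain_exists:
  assumes F: "spread F" "F \<noteq> {}" "F \<noteq> V" and m: "card V \<le> 2 ^ m"
    and no_cherry: "\<And>s c d. c \<in> V \<Longrightarrow> d \<in> V \<Longrightarrow> N c = {s} \<Longrightarrow> N d = {s} \<Longrightarrow> c = d"
  shows "gain F (2 * m + 1)"
proof (rule ccontr)
  assume ng: "\<not> gain F (2 * m + 1)"
  have FV: "F \<subseteq> V" using F(1) by (simp add: spread_def)
  obtain a x where ax: "a \<in> F" "x \<in> N a - F"
    using connected_V[OF FV F(2,3)] by (auto simp: in_N_iff)
  have "even_state F 0 F"
    using F(1) unfolding even_state_def
    by (intro conjI exI[of _ "{}"]) (auto simp: forces_def)
  from outside_pair[OF this _ ng ax] obtain y where y: "N a - F = {x, y}" "x \<noteq> y" by auto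
  \<comment> \<open>At most one of the two outside neighbours of \<open>a\<close> is a leaf hanging
    from \<open>a\<close>; \<open>b\<close> is chosen as one that is not.\<close>
  obtain b b' where b: "N a - F = {b, b'}" "b \<noteq> b'" "N b \<noteq> {a}"
  proof (cases "N x = {a}")
    case True
    have "x \<in> V" "y \<in> V" using y N_subset by blast+
    then have "N y \<noteq> {a}" using no_cherry[of x y a] True y(2) by blast
    with y that[of y x] show thesis by blast
  next
    case False
    with y that[of x y] show thesis by blast
  qed
  let ?Q = "{(p (Suc m - 1), p (Suc m)) | p. walk a b (Suc m) p}"
  have aV: "a \<in> V" using ax FV by blast
  have "2 ^ m = card ?Q" using card_walk_ends[OF ng F(1) ax(1) b, of "Suc m"] by simp
  also have "\<dots> = card (snd ` ?Q)"
  proof (rule card_image[symmetric])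
    \<comment> \<open>Here the budget is used in full: the joined walks have length
      \<open>2 * m + 2 = Suc (2 * m + 1)\<close>.\<close>
    show "inj_on snd ?Q"
      using walk_unique_last_step[OF ng F(1) ax(1) b, of "Suc m"] by (fastforce simp: inj_on_def)
  qed
  \<comment> \<open>Avoiding the single vertex \<open>a\<close> suffices: together with it,
    \<open>V\<close> has more than \<open>2 ^ m\<close> vertices.\<close>
  also have "\<dots> \<le> card (V - {a})"
  proof (rule card_mono)
    show "snd ` ?Q \<subseteq> V - {a}"
    proof (intro image_subsetI)
      fix e assume "e \<in> ?Q"
      then obtain p where p: "walk a b (Suc m) p" "snd e = p (Suc m)" by auto
      with walk_not_start[OF ng F(1) ax(1) b p(1)] walk_in_V[OF p(1) aV, of "Suc m"]
      show "snd e \<in> V - {a}" by simp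
    qed
  qed (use finite_V in simp)
  also have "\<dots> < card V" using aV finite_V by (intro psubset_card_mono) auto
  finally show False using m by simp
qed

section \<open>Iterating gains and counting payments\<close>

text \<open>The inequality bounds \<open>card X\<close> by \<open>k / (2 * k + 1)\<close> times the
  number of vertices outside \<open>F\<close>. A gain with \<open>x \<le> k\<close> payments infects
  at least \<open>2 * x + 1\<close> vertices, and
  \<open>(2 * k + 1) * (2 * x) \<le> 2 * k * (2 * x + 1)\<close>.\<close>

lemma forcing_extension:
  assumes F: "spread F" "F \<noteq> {}" and m: "card V \<le> 2 ^ m"
    and no_cherry: "\<And>s c d. c \<in> V \<Longrightarrow> d \<in> V \<Longrightarrow> N c = {s} \<Longrightarrow> N d = {s} \<Longrightarrow> c = d"
    and k: "k = 2 * m + 1"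
  shows "\<exists>X\<subseteq>V. forces (F \<union> X) V \<and> (2 * k + 1) * (2 * card X) + 2 * k * card F \<le> 2 * k * card V"
  using F
proof (induction "card V - card F" arbitrary: F rule: less_induct)
  case less
  show ?case
  proof (cases "F = V")
    case True
    then show ?thesis by (intro exI[of _ "{}"]) (auto simp: forces_def)
  next
    case False
    have "gain F k" unfolding k by (rule gain_exists[OF less.prems False m no_cherry])
    then obtain X Y where
      X: "X \<subseteq> V" "card X \<le> k" and Y: "F \<subseteq> Y" "forces (F \<union> X) Y" "spread Y"
      and card: "card F + 2 * card X + 1 \<le> card Y"
      unfolding gain_def by (elim exE conjE) (rule that)
    have "card Y \<le> card V" using Y(3) finite_V by (auto simp: spread_def intro: card_mono)
    then have "card V - card Y < card V - card F" using card by simp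
    from less.hyps[OF this Y(3)] Y(1) less.prems(2) obtain X' where
      X': "X' \<subseteq> V" "forces (Y \<union> X') V"
      and card': "(2 * k + 1) * (2 * card X') + 2 * k * card Y \<le> 2 * k * card V"
      by blast
    have "forces (F \<union> (X \<union> X')) V"
      using forces_trans[OF Y(2) X'(2)] by (simp add: Un_assoc)
    moreover have "(2 * k + 1) * (2 * card (X \<union> X')) + 2 * k * card F \<le> 2 * k * card V"
    proof -
      have "(2 * k + 1) * (2 * card (X \<union> X')) \<le> (2 * k + 1) * (2 * (card X + card X'))"
        using card_Un_le by (intro mult_le_mono) auto
      also have "\<dots> = 2 * k * (2 * card X) + 2 * card X + (2 * k + 1) * (2 * card X')"
        by (simp add: algebra_simps)
      also have "\<dots> \<le> 2 * k * (2 * card X) + 2 * k + (2 * k + 1) * (2 * card X')"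
        using X(2) by simp
      finally have "(2 * k + 1) * (2 * card (X \<union> X')) + 2 * k * card F
          \<le> 2 * k * (card F + 2 * card X + 1) + (2 * k + 1) * (2 * card X')"
        by (simp add: algebra_simps)
      also have "\<dots> \<le> 2 * k * card Y + (2 * k + 1) * (2 * card X')"
        using card by (intro add_mono mult_le_mono) auto
      finally show ?thesis using card' by simp
    qed
    ultimately show ?thesis using X(1) X'(1) by (intro exI[of _ "X \<union> X'"]) auto
  qed
qed

text \<open>The process starts from the two ends of an edge, a \<open>spread\<close> set. Their
  price \<open>(2 * k + 1) * 4\<close>, less the credit \<open>2 * k * 2\<close> for two infected
  vertices, is the additive \<open>4 * k + 4\<close>.\<close>

lemma forcing_set_without_cherries:
  assumes m: "card V \<le> 2 ^ m" and k: "k = 2 * m + 1"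
    and no_cherry: "\<And>s c d. c \<in> V \<Longrightarrow> d \<in> V \<Longrightarrow> N c = {s} \<Longrightarrow> N d = {s} \<Longrightarrow> c = d"
  shows "\<exists>Z\<subseteq>V. forces Z V \<and> (2 * k + 1) * (2 * card Z) \<le> 2 * k * card V + 4 * k + 4"
proof (cases "\<exists>w\<in>V. \<exists>a\<in>V. E w a")
  case False
  have "card V \<le> 1"
  proof (rule ccontr)
    assume "\<not> card V \<le> 1"
    then have "V \<noteq> {}" "\<And>w. V \<noteq> {w}" by auto
    then obtain w where w: "w \<in> V" "{w} \<noteq> V" by blast
    with connected_V[of "{w}"] False show False by auto
  qed
  then have "(2 * k + 1) * (2 * card V) \<le> (2 * k + 1) * 2" by (intro mult_le_mono) auto
  then show ?thesis by (intro exI[of _ V]) (auto simp: forces_def)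
next
  case True
  then obtain w a where wa: "w \<in> V" "a \<in> V" "E w a" by blast
  then have ne: "w \<noteq> a" using E_irrefl by auto
  have "spread {w, a}" using wa E_sym unfolding spread_def by auto
  note ext = forcing_extension[OF this _ m no_cherry k]
  obtain X where X: "X \<subseteq> V" "forces ({w, a} \<union> X) V"
    and "(2 * k + 1) * (2 * card X) + 2 * k * card {w, a} \<le> 2 * k * card V"
    by (rule exE[OF ext]) auto
  then have card_X: "(2 * k + 1) * (2 * card X) + 2 * k * 2 \<le> 2 * k * card V"
    using ne by simp
  have "card ({w, a} \<union> X) \<le> 2 + card X"
    using card_Un_le[of "{w, a}" X] ne by simp
  then have "(2 * k + 1) * (2 * card ({w, a} \<union> X)) \<le> (2 * k + 1) * (2 * (2 + card X))"
    by (intro mult_le_mono) auto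
  also have "\<dots> = (2 * k + 1) * (2 * card X) + 2 * k * 2 + 4 * k + 4" by (simp add: algebra_simps)
  also have "\<dots> \<le> 2 * k * card V + 4 * k + 4" using card_X by simp
  finally show ?thesis using X wa by (intro exI[of _ "{w, a} \<union> X"]) auto
qed

section \<open>Deleting a cherry: two leaves \<open>c\<close>, \<open>d\<close> with common
  neighbour \<open>s\<close>\<close>

context
  fixes s c d
  assumes cherry: "c \<in> V" "d \<in> V" "c \<noteq> d" "N c = {s}" "N d = {s}"
begin

lemma cherry_centre: "s \<in> V" "s \<noteq> c" "s \<noteq> d" "E s c" "E s d"
  using cherry E_irrefl by (auto simp: in_N_iff E_commute set_eq_iff)

lemma cherry_leaf: "x \<in> V \<Longrightarrow> E x c \<or> E x d \<Longrightarrow> x = s"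
  using cherry(4,5) in_N_iff[of x c] in_N_iff[of x d] E_commute[of x] by auto

text \<open>At most one edge joins the cherry to the rest, since \<open>c\<close> and
  \<open>d\<close> take two of the three places at \<open>s\<close>; hence the rest stays
  connected.\<close>

lemma remove_cherry: "subcubic_graph (V - {s, c, d}) E"
proof
  show "card {u \<in> V - {s, c, d}. E w u} \<le> 3" if "w \<in> V - {s, c, d}" for w
  proof -
    have "card {u \<in> V - {s, c, d}. E w u} \<le> card {u \<in> V. E w u}"
      using finite_V by (intro card_mono) auto
    also have "\<dots> \<le> 3" using deg that by blast
    finally show ?thesis .
  qed
  show "\<exists>x\<in>S. \<exists>y\<in>V - {s, c, d} - S. E x y"
    if S: "S \<subseteq> V - {s, c, d}" "S \<noteq> {}" "S \<noteq> V - {s, c, d}" for S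
  proof -
    obtain x where x: "x \<in> V - {s, c, d} - S" using S by blast
    show ?thesis
    proof (cases "\<exists>y\<in>S. E s y")
      case False
      have "S \<noteq> V" using x by blast
      with connected_V[of S] S obtain u v where "u \<in> S" "v \<in> V - S" "E u v" by blast
      moreover have "v \<noteq> c" "v \<noteq> d" "v \<noteq> s"
        using cherry_leaf[of u] False S(1) calculation E_commute by blast+
      ultimately show ?thesis by blast
    next
      case True
      then obtain y where y: "y \<in> S" "E s y" by blast
      \<comment> \<open>An edge leaving the enlarged set cannot start at a leaf, and from
        \<open>s\<close> it would reach a fourth neighbour; so it starts in
        \<open>S\<close>.\<close>
      let ?S = "S \<union> {s, c, d}"
      have "?S \<noteq> V" "?S \<subseteq> V" using x S cherry cherry_centre by blast+
      with connected_V[of ?S] obtain u v where uv: "u \<in> ?S" "v \<in> V - ?S" "E u v" by blast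
      have "u \<noteq> c" "u \<noteq> d" using cherry_leaf[of v] uv E_commute by blast+
      moreover have "u \<noteq> s"
      proof
        assume "u = s"
        then have "{c, d, y, v} \<subseteq> N s"
          using uv y S(1) cherry cherry_centre by (auto simp: in_N_iff)
        then have "card {c, d, y, v} \<le> 3"
          using card_N[OF cherry_centre(1)] card_mono[OF finite_N] le_trans by blast
        moreover have "c \<notin> {d, y, v}" "d \<notin> {y, v}" "y \<noteq> v"
          using cherry(3) y(1) S(1) uv(2) by blast+
        then have "card {c, d, y, v} = 4" by simp
        ultimately show False by simp
      qed
      ultimately show ?thesis using uv by blast
    qed
  qed
qed (use finite_V E_sym E_irrefl no_triangle no_square in blast)+

text \<open>\<open>c\<close> forces \<open>s\<close>. Since the remaining vertices lose no neighbour
  but \<open>s\<close>, a set stuck in the whole graph is then stuck in the rest as well. Finally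
  \<open>s\<close> forces \<open>d\<close>.\<close>

lemma forces_insert_cherry:
  assumes "subcubic_graph.forces (V - {s, c, d}) E Z (V - {s, c, d})"
  shows "forces (insert c Z) V"
  unfolding forces_def
proof (intro allI impI)
  interpret H: subcubic_graph "V - {s, c, d}" E by (rule remove_cherry)
  fix T assume T: "insert c Z \<subseteq> T" "stuck T"
  have s: "s \<in> T" using stuckD[OF T(2), of c s] cherry T(1) by auto
  have "H.stuck T"
    unfolding H.stuck_def
  proof (intro ballI allI notI)
    fix w u assume w: "w \<in> T \<inter> (V - {s, c, d})" and u: "H.N w - T = {u}"
    have "N w \<subseteq> H.N w \<union> {s}"
      using cherry_leaf[of w] w by (auto simp: in_N_iff H.in_N_iff)
    then have "N w - T \<subseteq> {u}" using u s by blast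
    moreover have "u \<in> N w" "u \<notin> T" using u by (auto simp: in_N_iff H.in_N_iff)
    ultimately show False using stuckD[OF T(2), of w u] w by blast
  qed
  with assms T(1) have "V - {s, c, d} \<subseteq> T" unfolding H.forces_def by blast
  moreover have "d \<in> N s" using cherry cherry_centre by (simp add: in_N_iff)
  moreover have "N s - T \<subseteq> {d}" using calculation(1) T(1) s N_subset by blast
  ultimately show "V \<subseteq> T"
    using stuckD[OF T(2) s cherry_centre(1)] T(1) s by blast
qed

end

end

text \<open>Each cherry trades one payment for three vertices, and
  \<open>(2 * k + 1) * 2 \<le> 2 * k * 3\<close> as \<open>k \<ge> 1\<close>. \<open>m\<close> stays
  fixed while \<open>V\<close> shrinks.\<close>

lemma subcubic_forcing_set:
  assumes "subcubic_graph V E" and "card V \<le> 2 ^ m" and k: "k = 2 * m + 1"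
  shows "\<exists>Z\<subseteq>V. subcubic_graph.forces V E Z V \<and>
    (2 * k + 1) * (2 * card Z) \<le> 2 * k * card V + 4 * k + 4"
  using assms(1,2)
proof (induction "card V" arbitrary: V rule: less_induct)
  case less
  interpret subcubic_graph V E by (rule less.prems(1))
  show ?case
  proof (cases "\<exists>s c d. c \<in> V \<and> d \<in> V \<and> c \<noteq> d \<and> N c = {s} \<and> N d = {s}")
    case False
    then show ?thesis using forcing_set_without_cherries[OF less.prems(2) k] by blast
  next
    case True
    then obtain s c d where cherry: "c \<in> V" "d \<in> V" "c \<noteq> d" "N c = {s}" "N d = {s}" by blast
    let ?V = "V - {s, c, d}"
    note centre = cherry_centre[OF cherry]
    have "card ?V = card V - card {s, c, d}"
      using centre cherry by (intro card_Diff_subset) auto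
    moreover have "card {s, c, d} = 3" using centre cherry(3) by auto
    moreover have "card {s, c, d} \<le> card V"
      using centre cherry finite_V by (intro card_mono) auto
    ultimately have V: "card V = card ?V + 3" by linarith
    with less.hyps[OF _ remove_cherry[OF cherry]] less.prems(2) obtain Z where
      Z: "Z \<subseteq> ?V" "subcubic_graph.forces ?V E Z ?V"
      "(2 * k + 1) * (2 * card Z) \<le> 2 * k * card ?V + 4 * k + 4" by auto
    have "forces (insert c Z) V" by (rule forces_insert_cherry[OF cherry Z(2)])
    moreover have "(2 * k + 1) * (2 * card (insert c Z)) \<le> 2 * k * card V + 4 * k + 4"
    proof -
      have "(2 * k + 1) * (2 * card (insert c Z)) \<le> (2 * k + 1) * (2 * (card Z + 1))"
        using card_insert_le_m1[of "Suc (card Z)" Z c] by (intro mult_le_mono) auto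
      also have "\<dots> = (2 * k + 1) * (2 * card Z) + 4 * k + 2" by (simp add: algebra_simps)
      also have "\<dots> \<le> 2 * k * card ?V + 4 * k + 4 + 2 * k * 3" using Z(3) k by linarith
      finally show ?thesis unfolding V by (simp add: algebra_simps)
    qed
    ultimately show ?thesis using Z(1) cherry(1) by (intro exI[of _ "insert c Z"]) auto
  qed
qed

section \<open>Transfer between the digraph notions and the relational setting\<close>

lemma girth_le_cycle:
  assumes "pre_digraph.cycle (with_proj G) p" "3 \<le> length p"
  shows "girth G \<le> enat (length p)"
  unfolding girth_def using assms by (intro INF_lower) auto

lemma subcubic_graph_pair_graph:
  assumes "pair_graph G" and conn: "Digraph_Component.connected (with_proj G)"
    and deg: "max_degree G \<le> 3" and girth: "girth G \<ge> 5"
  shows "subcubic_graph (pverts G) (\<lambda>x y. (x, y) \<in> parcs G)"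
proof -
  interpret pair_graph G by (rule assms(1))
  have fin: "finite (pverts G)" by simp
  have sym: "(y, x) \<in> parcs G" if "(x, y) \<in> parcs G" for x y
    using that pair_sym_arcs by (auto simp: symmetric_def sym_def)
  have irrefl: "(x, x) \<notin> parcs G" for x
    using pair_no_loops by fastforce
  have verts: "x \<in> pverts G" "y \<in> pverts G" if "(x, y) \<in> parcs G" for x y
    using that arc_fst_in_verts arc_snd_in_verts by fastforce+
  show ?thesis
  proof
    show "\<not> (z, x) \<in> parcs G" if "(x, y) \<in> parcs G" "(y, z) \<in> parcs G" for x y z
    proof
      assume "(z, x) \<in> parcs G"
      moreover from this that have "x \<noteq> y" "y \<noteq> z" "z \<noteq> x" using irrefl by auto
      ultimately have "pre_digraph.cycle (with_proj G) [(x, y), (y, z), (z, x)]"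
        using that verts by (auto simp: cycle_def awalk_def intro!: exI[of _ x])
      from girth_le_cycle[OF this] have "girth G \<le> enat 3" by (simp add: eval_nat_numeral)
      with girth have "(5::enat) \<le> enat 3" by (rule order_trans)
      then show False by (simp add: numeral_eq_enat)
    qed
    show "y = w" if "(x, y) \<in> parcs G" "(y, z) \<in> parcs G" "(z, w) \<in> parcs G"
      "(w, x) \<in> parcs G" "x \<noteq> z" for x y z w
    proof (rule ccontr)
      assume "y \<noteq> w"
      moreover from that have "x \<noteq> y" "y \<noteq> z" "z \<noteq> w" "w \<noteq> x" using irrefl by auto
      ultimately have "pre_digraph.cycle (with_proj G) [(x, y), (y, z), (z, w), (w, x)]"
        using that verts by (auto simp: cycle_def awalk_def intro!: exI[of _ x])
      from girth_le_cycle[OF this] have "girth G \<le> enat 4" by (simp add: eval_nat_numeral)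
      with girth have "(5::enat) \<le> enat 4" by (rule order_trans)
      then show False by (simp add: numeral_eq_enat)
    qed
    show "card {u \<in> pverts G. (w, u) \<in> parcs G} \<le> 3" if "w \<in> pverts G" for w
    proof -
      have "out_arcs (with_proj G) w = Pair w ` {u \<in> pverts G. (w, u) \<in> parcs G}"
        using verts by (auto simp: out_arcs_def)
      then have "out_degree (with_proj G) w = card {u \<in> pverts G. (w, u) \<in> parcs G}"
        unfolding out_degree_def by (simp add: card_image inj_on_def)
      moreover have "out_degree (with_proj G) w \<le> max_degree G"
        unfolding max_degree_def using that by (intro Max_ge) auto
      ultimately show ?thesis using deg by simp
    qed
    show "\<exists>x\<in>S. \<exists>y\<in>pverts G - S. (x, y) \<in> parcs G"
      if S: "S \<subseteq> pverts G" "S \<noteq> {}" "S \<noteq> pverts G" for S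
    proof (rule ccontr)
      assume no: "\<not> ?thesis"
      obtain a b where ab: "a \<in> S" "b \<in> pverts G - S" using S by blast
      \<comment> \<open>Connectedness means strong connectedness of the symmetric closure, which
        adds no arcs here.\<close>
      have arcs: "arcs_ends (with_proj (mk_symmetric (with_proj G))) = parcs G"
        using sym by (auto simp: parcs_mk_symmetric arcs_ends_conv)
      have reach: "a \<rightarrow>\<^sup>*\<^bsub>with_proj (mk_symmetric (with_proj G))\<^esub> b"
        using conn ab S(1) unfolding connected_def strongly_connected_def by auto
      have "(a, b) \<in> (parcs G)\<^sup>*" using reachable_rtranclI[OF reach] unfolding arcs .
      then have "b \<in> S"
      proof (induction rule: rtrancl_induct)
        case (step x y)
        with no verts show ?case by blast
      qed (rule ab(1))
      with ab(2) show False by blast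
    qed
  qed (use fin sym irrefl in auto)
qed

text \<open>The closure is itself a stuck superset of \<open>Z\<close>, so \<open>forces\<close>
  puts every vertex into it; that \<open>pverts G\<close> is stuck bounds it from above.\<close>

lemma zero_forcing_number_le:
  assumes "pair_graph G" and "subcubic_graph (pverts G) (\<lambda>x y. (x, y) \<in> parcs G)"
    and Z: "Z \<subseteq> pverts G" "subcubic_graph.forces (pverts G) (\<lambda>x y. (x, y) \<in> parcs G) Z (pverts G)"
  shows "zero_forcing_number G \<le> card Z"
proof -
  interpret G: pair_graph G by (rule assms(1))
  interpret subcubic_graph "pverts G" "\<lambda>x y. (x, y) \<in> parcs G" by (rule assms(2))
  have N: "N w = nbhd G w" for w
    unfolding N_def nbhd_def using G.arc_snd_in_verts by fastforce
  have "(force_step G)\<^sup>*\<^sup>* Z (forcing_closure G Z)" "\<nexists>U. force_step G (forcing_closure G Z) U"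
    using theI'[OF forcing_closure_unique[OF assms(1) Z(1)]] unfolding forcing_closure_def by auto
  moreover have "stuck T" if "\<nexists>U. force_step G T U" for T
    using that unfolding stuck_def force_step_def N by blast
  ultimately have "pverts G \<subseteq> forcing_closure G Z"
    using Z(2) force_steps_increasing unfolding forces_def by blast
  moreover have "forcing_closure G Z \<subseteq> pverts G"
  proof (rule force_steps_subset_stuck)
    show "\<nexists>U. force_step G (pverts G) U"
      unfolding force_step_def N[symmetric] using N_subset by blast
  qed fact+
  ultimately have "zero_forcing_set G Z" using Z(1) by (simp add: zero_forcing_set_def)
  moreover have "{Z. zero_forcing_set G Z} \<subseteq> Pow (pverts G)" by (auto simp: zero_forcing_set_def)
  then have "finite {Z. zero_forcing_set G Z}" by (rule finite_subset) simp
  ultimately show ?thesis unfolding zero_forcing_number_def by (intro Min_le) auto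
qed

section \<open>Arithmetic of the bound, and assembly\<close>

lemma bound_arith:
  fixes n z k L :: real
  assumes "(2 * k + 1) * (2 * z) \<le> 2 * k * n + 4 * k + 4" and "2 \<le> n"
    and "1 \<le> k" "2 * k + 1 \<le> 4 * L + 7" and "1 \<le> L"
  shows "z \<le> n / 2 - n / (24 * L + 6) + 2"
proof -
  define d where "d = 2 * k + 1"
  have d: "3 \<le> d" using assms(3) by (simp add: d_def)
  have "d * (2 * z) \<le> (d - 1) * n + 2 * d + 2" using assms(1) by (simp add: d_def)
  then have "z \<le> ((d - 1) * n + 2 * d + 2) / (2 * d)"
    using d by (simp add: field_simps)
  also have "\<dots> = n / 2 - n / (2 * d) + 1 + 1 / d"
    using d by (simp add: field_simps)
  also have "\<dots> \<le> n / 2 - n / (2 * d) + 2" using d by simp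
  also have "\<dots> \<le> n / 2 - n / (24 * L + 6) + 2"
  proof -
    \<comment> \<open>\<open>2 * d \<le> 8 * L + 14 \<le> 24 * L + 6\<close>, the latter because
      \<open>L\<close> is at least 1.\<close>
    have "n / (24 * L + 6) \<le> n / (2 * d)"
      using assms d by (intro divide_left_mono) (auto simp: d_def)
    then show ?thesis by simp
  qed
  finally show ?thesis .
qed

theorem theorem2:
  fixes G :: "'a pair_pre_digraph" and n :: nat
  assumes "pair_graph G"
    and "Digraph_Component.connected (with_proj G)"
    and "card (pverts G) = n"
    and "max_degree G = 3"
    and "girth G \<ge> 5"
  shows "real (zero_forcing_number G)
           \<le> real n / 2 - real n / (24 * log 2 (real n) + 6) + 2"
proof -
  let ?E = "\<lambda>x y. (x, y) \<in> parcs G"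
  interpret G: pair_graph G by (rule assms(1))
  have sub: "subcubic_graph (pverts G) ?E"
    using subcubic_graph_pair_graph[OF assms(1,2)] assms(4,5) by simp
  define m where "m = nat \<lceil>log 2 (real n)\<rceil>"
  \<comment> \<open>A lone vertex has degree 0. With two vertices or more, the logarithm is at least
    1.\<close>
  have n: "2 \<le> n"
  proof (rule ccontr)
    assume "\<not> 2 \<le> n"
    moreover have ne: "pverts G \<noteq> {}"
      using assms(2) unfolding connected_def strongly_connected_def by simp
    ultimately have "n = 1" using assms(3) by (cases n) auto
    with assms(3) obtain v where v: "pverts G = {v}" by (auto simp: card_1_singleton_iff)
    have "parcs G = {}"
      using G.arc_fst_in_verts G.arc_snd_in_verts G.pair_no_loops v by fastforce
    then have "max_degree G = 0" by (simp add: max_degree_def v out_degree_def out_arcs_def)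
    with assms(4) show False by simp
  qed
  then have L: "1 \<le> log 2 (real n)" by (simp add: le_log_iff)
  have "real n = 2 powr log 2 (real n)" using n by simp
  also have "\<dots> \<le> 2 powr real m" unfolding m_def using L by (intro powr_mono) linarith+
  also have "\<dots> = real (2 ^ m)" by (simp add: powr_realpow)
  finally have "n \<le> 2 ^ m" by (simp only: of_nat_le_iff)
  then obtain Z where Z: "Z \<subseteq> pverts G" "subcubic_graph.forces (pverts G) ?E Z (pverts G)"
    and card: "(2 * (2 * m + 1) + 1) * (2 * card Z) \<le> 2 * (2 * m + 1) * n + 4 * (2 * m + 1) + 4"
    using subcubic_forcing_set[OF sub, of m] assms(3) by blast
  have "real (card Z) \<le> real n / 2 - real n / (24 * log 2 (real n) + 6) + 2"
  proof (rule bound_arith)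
    show "(2 * real (2 * m + 1) + 1) * (2 * real (card Z))
        \<le> 2 * real (2 * m + 1) * real n + 4 * real (2 * m + 1) + 4"
      using card unfolding of_nat_le_iff[where 'a = real, symmetric] by (simp add: algebra_simps)
    \<comment> \<open>The left side is \<open>4 * m + 3\<close>, and rounding up makes
      \<open>m\<close> exceed the logarithm by at most 1.\<close>
    show "2 * real (2 * m + 1) + 1 \<le> 4 * log 2 (real n) + 7"
      unfolding m_def using L by simp linarith
  qed (use n L in auto)
  with zero_forcing_number_le[OF assms(1) sub Z] show ?thesis by linarith
qed

end
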